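(* Let $S$ be a Clifford semigroup and $s(a,b)=(ab,\theta_a(b))$ a solution on $S$. Then the kernel $K$ of $s$ is a normal subsemigroup of $S$.
   Context: A semigroup $S$ is inverse if for each $a\in S$ there is a unique $a^{-1}\in S$ with $aa^{-1}a=a$ and $a^{-1}aa^{-1}=a^{-1}$; it is a Clifford semigroup if moreover its idempotents are central (equivalently $aa^{-1}=a^{-1}a$ for all $a$). $\mathrm{E}(S)$ is the set of idempotents. For $a,b\in S$, write $a\le b$ if $aa^{-1}\cdot bb^{-1}=aa^{-1}$ (a preorder on $S$). A solution (of the pentagon equation) on a semigroup $S$ is a map $s:S\times S\to S\times S$, $s(a,b)=(ab,\theta_a(b))$, where $ab$ is the product of $S$ and $\theta_a:S\to S$ are maps satisfying $\theta_a(b)\theta_{ab}(c)=\theta_a(bc)$ and $\theta_{\theta_a(b)}\theta_{ab}=\theta_b$ (composition of maps) for all $a,b,c\in S$. The kernel of $s$ is $K=\{a\in S\mid \theta_e(a)\in\mathrm{E}(S)\text{ for all } e\in\mathrm{E}(S)\text{ with } e\le a\}$. A normal subsemigroup of $S$ is a subsemigroup $K$ with $\mathrm{E}(S)\subseteq K$ and $a^{-1}Ka\subseteq K$ for every $a\in S$. *)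

theory Defs
  imports Main
begin

class inverse_semigroup = semigroup_mult +
  assumes ex1_sinv: "\<exists>!x. a * x * a = a \<and> x * a * x = x"

definition idems :: "'a::semigroup_mult set" where
  "idems = {e. e * e = e}"

definition sinv :: "'a::inverse_semigroup \<Rightarrow> 'a" where
  "sinv a = (THE x. a * x * a = a \<and> x * a * x = x)"

lemma sinv_left: "a * sinv a * a = a"
  and sinv_right: "sinv a * a * sinv a = sinv a"
  unfolding sinv_def using theI'[OF ex1_sinv, of a] by blast+

lemma sinv_unique: "a * x * a = a \<Longrightarrow> x * a * x = x \<Longrightarrow> x = sinv a"
  using ex1_sinv[of a] sinv_left sinv_right by metis

class clifford_semigroup = inverse_semigroup +
  assumes idem_central: "e * e = e \<Longrightarrow> e * a = a * e"

definition sle :: "'a::inverse_semigroup \<Rightarrow> 'a \<Rightarrow> bool"  (infix "\<preceq>" 50) where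
  "a \<preceq> b \<longleftrightarrow> (a * sinv a) * (b * sinv b) = a * sinv a"

definition theta :: "('a \<times> 'a \<Rightarrow> 'a \<times> 'a) \<Rightarrow> 'a \<Rightarrow> 'a \<Rightarrow> 'a" where
  "theta s a b = snd (s (a, b))"

definition pentagon_solution :: "('a::semigroup_mult \<times> 'a \<Rightarrow> 'a \<times> 'a) \<Rightarrow> bool" where
  "pentagon_solution s \<longleftrightarrow>
     (\<forall>a b. s (a, b) = (a * b, theta s a b)) \<and>
     (\<forall>a b c. theta s a b * theta s (a * b) c = theta s a (b * c)) \<and>
     (\<forall>a b. theta s (theta s a b) \<circ> theta s (a * b) = theta s b)"

definition kernel :: "('a::inverse_semigroup \<times> 'a \<Rightarrow> 'a \<times> 'a) \<Rightarrow> 'a set" where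
  "kernel s = {a. \<forall>e\<in>idems. e \<preceq> a \<longrightarrow> theta s e a \<in> idems}"

definition subsemigroup :: "'a::semigroup_mult set \<Rightarrow> bool" where
  "subsemigroup K \<longleftrightarrow> K \<noteq> {} \<and> (\<forall>x\<in>K. \<forall>y\<in>K. x * y \<in> K)"

definition normal_subsemigroup :: "'a::inverse_semigroup set \<Rightarrow> bool" where
  "normal_subsemigroup K \<longleftrightarrow>
     subsemigroup K \<and> idems \<subseteq> K \<and> (\<forall>a. \<forall>k\<in>K. sinv a * k * a \<in> K)"

end

theory Submission
  imports Defs
begin

text \<open>
  Fix an idempotent e, let G be its maximal subgroup and put u = \<theta> e e. Every \<theta> x with x \<in> G
  maps G into the maximal subgroup of u, and \<theta> x is the composition of \<theta> y and \<theta> e, where y is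
  the inverse of \<theta> e (sinv x). Hence if k \<in> G and \<theta> e k is idempotent, then right translation
  of the index by k is invisible: \<theta> (x * k) = \<theta> x for x \<in> G. Moreover, if b lies above e, then
  \<theta> x b is idempotent for all x \<in> G as soon as \<theta> e b is. So in
  \<theta> e (sinv a * k * a) = \<theta> e (sinv a) * \<theta> x k * \<theta> (x * k) a with x = e * sinv a and k in the
  kernel, the middle factor is a central idempotent and the outer factors multiply to the
  idempotent \<theta> e (sinv a * a).
\<close>

section \<open>Clifford semigroups\<close>

lemma sinv_cancel [simp]:
  "a * (sinv a * a) = a" "a * (sinv a * (a * b)) = a * b"
  "sinv a * (a * sinv a) = sinv a" "sinv a * (a * (sinv a * b)) = sinv a * b"
  using sinv_left[of a] sinv_right[of a] by (simp_all flip: mult.assoc)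

lemma sinv_sinv [simp]: "sinv (sinv a) = a"
  using sinv_unique[of "sinv a" a] by (simp add: mult.assoc)

lemma sinv_idem: "e * e = e \<Longrightarrow> sinv e = e"
  using sinv_unique[of e e] by simp

text \<open>Centrality moves each of the idempotents \<open>a * sinv a\<close> and
  \<open>sinv a * a\<close> through \<open>a\<close> or \<open>sinv a\<close>, so both equal their
  common product.\<close>

lemma sinv_comm: "sinv a * a = a * sinv a" for a :: "'a::clifford_semigroup"
proof -
  let ?p = "a * sinv a" and ?q = "sinv a * a"
  have p: "?p * ?p = ?p" and q: "?q * ?q = ?q"
    by (simp_all add: mult.assoc)
  have "?q = sinv a * ?p * a"
    by (simp add: mult.assoc)
  also have "\<dots> = ?p * ?q"
    unfolding idem_central[OF p, of "sinv a", symmetric] by (rule mult.assoc)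
  also have "\<dots> = ?q * ?p"
    by (rule idem_central[OF p])
  also have "\<dots> = a * ?q * sinv a"
    unfolding idem_central[OF q, of a, symmetric] by (rule mult.assoc[symmetric])
  also have "\<dots> = ?p"
    by (simp add: mult.assoc)
  finally show ?thesis .
qed

lemma sinv_mult: "sinv (a * b) = sinv b * sinv a" for a b :: "'a::clifford_semigroup"
proof -
  let ?p = "b * sinv b" and ?q = "sinv a * a"
  have p: "?p * ?p = ?p" and q: "?q * ?q = ?q"
    by (simp_all add: mult.assoc)
  have pq: "?p * ?q = ?q * ?p"
    using idem_central[OF p] .
  have "a * b * (sinv b * sinv a) * (a * b) = a * (?p * ?q) * b"
    by (simp only: mult.assoc)
  also have "\<dots> = a * b"
    unfolding pq by (simp add: mult.assoc)
  finally have 1: "a * b * (sinv b * sinv a) * (a * b) = a * b" .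
  have "sinv b * sinv a * (a * b) * (sinv b * sinv a) = sinv b * (?q * ?p) * sinv a"
    by (simp only: mult.assoc)
  also have "\<dots> = sinv b * sinv a"
    unfolding pq[symmetric] by (simp add: mult.assoc)
  finally show ?thesis
    using sinv_unique[OF 1] by simp
qed

lemma idem_mult:
  fixes e f :: "'a::clifford_semigroup"
  assumes "e * e = e" "f * f = f"
  shows "(e * f) * (e * f) = e * f"
  using idem_central[OF assms(1), of f] assms by (metis mult.assoc)

text \<open>An idempotent that fixes \<open>a * b\<close> also fixes the idempotent of
  \<open>a * b\<close>, hence absorbs into \<open>e\<close>. Both \<open>a * sinv a\<close> and
  \<open>b * sinv b\<close> fix \<open>a * b\<close>, the latter by centrality.\<close>

lemma below_mult:
  fixes e a b :: "'a::clifford_semigroup"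
  assumes e: "e * (a * b * sinv (a * b)) = e"
  shows "e * (a * sinv a) = e" and "e * (b * sinv b) = e"
proof -
  have below: "e * f = e" if f: "f * f = f" and "f * (a * b) = a * b" for f
    using that idem_central[OF f] e by (metis mult.assoc)
  have pb: "b * sinv b * (b * sinv b) = b * sinv b"
    by (simp add: mult.assoc)
  have "b * sinv b * (a * b) = a * (b * sinv b) * b"
    using idem_central[OF pb, of a] by (metis mult.assoc)
  then show "e * (b * sinv b) = e"
    using below[OF pb] by (simp add: mult.assoc)
  show "e * (a * sinv a) = e"
    by (rule below) (simp_all add: mult.assoc)
qed

lemma below_translate:
  fixes e a :: "'a::clifford_semigroup"
  assumes e: "e * e = e" and a: "e * (a * sinv a) = e"
  shows "e * a * sinv (e * a) = e"
proof -
  have "e * a * sinv (e * a) = e * (a * sinv a) * e"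
    by (simp add: sinv_mult sinv_idem[OF e] mult.assoc)
  then show ?thesis
    using e a by simp
qed

lemma sle_idem: "e * e = e \<Longrightarrow> e \<preceq> a \<longleftrightarrow> e * (a * sinv a) = e" for e :: "'a::inverse_semigroup"
  by (simp add: sle_def sinv_idem)

text \<open>The hypothesis encodes membership of \<open>x\<close> in the maximal subgroup with
  identity \<open>e\<close>; these are its group laws.\<close>

lemma unit_sinv:
  fixes x e :: "'a::clifford_semigroup"
  assumes "x * sinv x = e"
  shows "e * e = e" "e * x = x" "x * e = x" "sinv x * x = e"
    "e * sinv x = sinv x" "sinv x * e = sinv x"
proof -
  show c: "sinv x * x = e"
    using assms sinv_comm[of x] by simp
  show "e * e = e" "e * x = x" "sinv x * e = sinv x"
    by (simp_all add: mult.assoc flip: assms)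
  show "x * e = x" "e * sinv x = sinv x"
    by (simp_all add: mult.assoc flip: c)
qed

lemma unit_mult:
  fixes x y e :: "'a::clifford_semigroup"
  assumes "x * sinv x = e" and y: "y * sinv y = e"
  shows "x * y * sinv (x * y) = e"
proof -
  have "x * y * sinv (x * y) = x * (y * sinv y) * sinv x"
    by (simp add: sinv_mult mult.assoc)
  then show ?thesis
    using unit_sinv[OF assms(1)] assms by simp
qed

section \<open>Solutions of the pentagon equation\<close>

locale pentagon =
  fixes \<theta> :: "'a::clifford_semigroup \<Rightarrow> 'a \<Rightarrow> 'a"
  assumes theta_mult: "\<theta> a (b * c) = \<theta> a b * \<theta> (a * b) c"
    and theta_theta: "\<theta> (\<theta> a b) (\<theta> (a * b) c) = \<theta> b c"
begin

lemma theta_idem: "f * f = f \<Longrightarrow> a * f = a \<Longrightarrow> \<theta> a f * \<theta> a f = \<theta> a f"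
  using theta_mult[of a f f] by simp

text \<open>With \<open>y = \<theta> (sinv x) x\<close>, \<open>theta_theta\<close> gives
  \<open>\<theta> x b = \<theta> y (\<theta> e b)\<close>. By \<open>theta_idem\<close> it then
  suffices that \<open>y\<close> absorbs \<open>\<theta> e b\<close> on the right.\<close>

lemma theta_idem_transfer:
  assumes x: "x * sinv x = e" and b: "e * (b * sinv b) = e"
    and idem: "\<theta> e b * \<theta> e b = \<theta> e b"
  shows "\<theta> x b * \<theta> x b = \<theta> x b"
proof -
  note X = unit_sinv[OF x]
  define y where "y = \<theta> (sinv x) x"
  \<comment> \<open>Since \<open>e\<close> lies below \<open>b\<close>, inserting
    \<open>b * sinv b\<close> after \<open>x\<close> changes nothing, but it exhibits the central
    idempotent \<open>\<theta> e b\<close> as a factor of \<open>y\<close>.\<close>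
  have "x * (b * sinv b) = x * e * (b * sinv b)"
    by (simp add: X)
  also have "\<dots> = x"
    by (simp only: mult.assoc b) (simp add: X)
  finally have "x = x * (b * sinv b)" by simp
  then have "y = \<theta> (sinv x) (x * (b * sinv b))"
    by (simp add: y_def)
  also have "\<dots> = y * (\<theta> e b * \<theta> (e * b) (sinv b))"
    by (simp add: theta_mult y_def X)
  finally have "y = \<theta> e b * (y * \<theta> (e * b) (sinv b))"
    using idem_central[OF idem, of y] by (metis mult.assoc)
  then have "\<theta> e b * y = y"
    using idem by (metis mult.assoc)
  then have "y * \<theta> e b = y"
    using idem_central[OF idem, of y] by simp
  moreover have "\<theta> y (\<theta> e b) = \<theta> x b"
    using theta_theta[of "sinv x" x b] by (simp add: y_def X)
  ultimately show ?thesis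
    using theta_idem[OF idem] by metis
qed

text \<open>The idempotents \<open>\<theta> y e\<close> can only grow when \<open>y\<close> is
  multiplied on the right inside the group. Multiplying by \<open>x\<close> and then by
  \<open>sinv x\<close> returns to \<open>e\<close>, so they all coincide.\<close>

lemma theta_unit_const:
  assumes x: "x * sinv x = e"
  shows "\<theta> x e = \<theta> e e"
proof -
  have le: "\<theta> y e * \<theta> (y * b) e = \<theta> y e" if y: "y * sinv y = e" and b: "b * sinv b = e" for y b
  proof -
    note Y = unit_sinv[OF y] and B = unit_sinv[OF b]
    have "\<theta> y e = \<theta> y b * \<theta> (y * b) (sinv b)"
      using theta_mult[of y b "sinv b"] b by simp
    moreover have "\<theta> y b = \<theta> y b * \<theta> (y * b) e"
      using theta_mult[of y b e] B by simp
    moreover have "\<theta> (y * b) e * \<theta> (y * b) e = \<theta> (y * b) e"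
      by (rule theta_idem) (simp_all add: B mult.assoc)
    ultimately show ?thesis
      using idem_central by (metis mult.assoc)
  qed
  note X = unit_sinv[OF x]
  have e: "e * sinv e = e"
    using X(1) by (simp add: sinv_idem)
  have 1: "\<theta> e e * \<theta> x e = \<theta> e e"
    using le[OF e x] X by simp
  have 2: "\<theta> x e * \<theta> e e = \<theta> x e"
    using le[OF x, of "sinv x"] X x by simp
  have "\<theta> e e * \<theta> e e = \<theta> e e"
    using theta_idem X(1) by blast
  then show ?thesis
    using idem_central[of "\<theta> e e" "\<theta> x e"] 1 2 by simp
qed

text \<open>The element \<open>\<theta> x b\<close> has \<open>\<theta> e e\<close> as left
  identity, and \<open>\<theta> (x * b) (sinv b)\<close> is a right inverse of it with respect to
  that identity.\<close>

lemma theta_unit: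
  assumes x: "x * sinv x = e" and b: "b * sinv b = e"
  shows "\<theta> x b * sinv (\<theta> x b) = \<theta> e e"
proof -
  note X = unit_sinv[OF x] and B = unit_sinv[OF b]
  let ?u = "\<theta> e e" and ?t = "\<theta> x b"
  have ut: "?u * ?t = ?t"
    using theta_mult[of x e b] by (simp add: X B theta_unit_const[OF x])
  have tz: "?t * \<theta> (x * b) (sinv b) = ?u"
    using theta_mult[of x b "sinv b"] by (simp add: b theta_unit_const[OF x])
  have u: "?u * ?u = ?u"
    using theta_idem X(1) by blast
  have "?t * sinv ?t = ?u * (?t * sinv ?t)"
    using ut by (simp flip: mult.assoc)
  also have "\<dots> = ?t * sinv ?t * ?u"
    by (rule idem_central[OF u])
  also have "\<dots> = ?u"
    unfolding tz[symmetric] by (simp add: mult.assoc)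
  finally show ?thesis .
qed

text \<open>Expanding \<open>\<theta> e (sinv x * x)\<close> shows that
  \<open>\<theta> (sinv x) x\<close> is the group inverse of \<open>\<theta> e (sinv x)\<close>.
  Thus \<open>\<theta> x\<close> depends on \<open>x\<close> only through
  \<open>\<theta> e (sinv x)\<close>.\<close>

lemma theta_factor:
  assumes x: "x * sinv x = e"
  shows "\<theta> x c = \<theta> (sinv (\<theta> e (sinv x))) (\<theta> e c)"
proof -
  note X = unit_sinv[OF x]
  have e: "e * sinv e = e"
    using X(1) by (simp add: sinv_idem)
  have x': "sinv x * sinv (sinv x) = e"
    by (simp add: X)
  note A = unit_sinv[OF theta_unit[OF e x']] and Y = unit_sinv[OF theta_unit[OF x' x]]
  have "\<theta> e (sinv x) * \<theta> (sinv x) x = \<theta> e e"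
    using theta_mult[of e "sinv x" x] by (simp add: X)
  then have "\<theta> (sinv x) x = sinv (\<theta> e (sinv x))"
    using A Y by (metis mult.assoc)
  then show ?thesis
    using theta_theta[of "sinv x" x c] by (simp add: X)
qed

text \<open>By \<open>theta_factor\<close> it is enough that \<open>\<theta> e\<close> agrees on
  \<open>sinv (x * k)\<close> and \<open>sinv x\<close>.\<close>

lemma theta_translate:
  assumes x: "x * sinv x = e" and k: "k * sinv k = e"
    and idem: "\<theta> e k * \<theta> e k = \<theta> e k"
  shows "\<theta> (x * k) c = \<theta> x c"
proof -
  note X = unit_sinv[OF x] and K = unit_sinv[OF k]
  let ?u = "\<theta> e e"
  have e: "e * sinv e = e"
    using X(1) by (simp add: sinv_idem)
  have x': "sinv x * sinv (sinv x) = e" and k': "sinv k * sinv (sinv k) = e"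
    by (simp_all add: X K)
  have u: "?u * ?u = ?u"
    using theta_idem X(1) by blast
  \<comment> \<open>An idempotent in a group is its identity.\<close>
  have ku: "\<theta> e k = ?u"
    using theta_unit[OF e k] idem by (simp add: sinv_idem)
  have "\<theta> (sinv k) d = \<theta> e d" for d
    using theta_factor[OF k', of d] theta_theta[of e e d] by (simp add: ku sinv_idem u X)
  then have k'_eq: "\<theta> (sinv k) = \<theta> e" ..
  have "\<theta> e (sinv k) * ?u = ?u"
    using theta_mult[of e "sinv k" k] by (simp add: K k'_eq ku)
  then have "\<theta> e (sinv k) = ?u"
    using unit_sinv[OF theta_unit[OF e k']] by simp
  then have "\<theta> e (sinv (x * k)) = ?u * \<theta> e (sinv x)"
    using theta_mult[of e "sinv k" "sinv x"] by (simp add: sinv_mult K k'_eq)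
  also have "\<dots> = \<theta> e (sinv x)"
    using unit_sinv[OF theta_unit[OF e x']] by simp
  finally show ?thesis
    using theta_factor[OF x] theta_factor[OF unit_mult[OF x k]] by simp
qed

text \<open>In \<open>\<theta> e (a * b) = \<theta> e a * \<theta> (e * a) b\<close> the index
  \<open>e * a\<close> lies in the group of \<open>e\<close>, so idempotency transfers to the second
  factor.\<close>

lemma theta_mult_idem:
  assumes e: "e * e = e" and ab: "e * (a * b * sinv (a * b)) = e"
    and a: "\<theta> e a * \<theta> e a = \<theta> e a" and b: "\<theta> e b * \<theta> e b = \<theta> e b"
  shows "\<theta> e (a * b) * \<theta> e (a * b) = \<theta> e (a * b)"
proof -
  note A = below_mult[OF ab]
  have "\<theta> (e * a) b * \<theta> (e * a) b = \<theta> (e * a) b"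
    using theta_idem_transfer[OF below_translate[OF e A(1)] A(2) b] .
  then show ?thesis
    using idem_mult[OF a] by (simp add: theta_mult)
qed

lemma theta_conjugate_idem:
  assumes e: "e * e = e" and c: "e * (sinv a * k * a * sinv (sinv a * k * a)) = e"
    and k: "\<theta> e k * \<theta> e k = \<theta> e k"
  shows "\<theta> e (sinv a * k * a) * \<theta> e (sinv a * k * a) = \<theta> e (sinv a * k * a)"
proof -
  note ea = below_mult(2)[OF c] and le = below_mult[OF below_mult(1)[OF c]]
  define x where "x = e * sinv a"
  have x: "x * sinv x = e"
    unfolding x_def using below_translate[OF e le(1)] .
  note X = unit_sinv[OF x]
  have ek: "e * k * sinv (e * k) = e"
    using below_translate[OF e le(2)] .
  have uu: "\<theta> e e * \<theta> e e = \<theta> e e"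
    using theta_idem e by blast
  \<comment> \<open>The element \<open>k\<close> is only above \<open>e\<close>;
    \<open>e * k\<close> lies in the group of \<open>e\<close>, and
    \<open>x * (e * k) = x * k\<close>.\<close>
  have "\<theta> e (e * k) = \<theta> e e * \<theta> e k"
    by (simp add: theta_mult e)
  then have "\<theta> e (e * k) * \<theta> e (e * k) = \<theta> e (e * k)"
    using idem_mult[OF uu k] by simp
  from theta_translate[OF x ek this] have tr: "\<theta> (x * k) a = \<theta> x a"
    using X by (metis mult.assoc)
  have f: "\<theta> x k * \<theta> x k = \<theta> x k"
    using theta_idem_transfer[OF x le(2) k] .
  have "\<theta> e (sinv a * k * a) = \<theta> e (sinv a) * (\<theta> x k * \<theta> x a)"
    by (simp add: theta_mult mult.assoc tr[unfolded x_def mult.assoc] x_def)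
  also have "\<dots> = \<theta> e (sinv a) * (\<theta> x a * \<theta> x k)"
    using idem_central[OF f] by simp
  also have "\<dots> = \<theta> e (sinv a * a) * \<theta> x k"
    by (simp add: theta_mult mult.assoc x_def)
  finally have eq: "\<theta> e (sinv a * k * a) = \<theta> e (sinv a * a) * \<theta> x k" .
  \<comment> \<open>\<open>theta_idem\<close> applies because \<open>e\<close> absorbs
    \<open>sinv a * a\<close>.\<close>
  have "\<theta> e (sinv a * a) * \<theta> e (sinv a * a) = \<theta> e (sinv a * a)"
    by (rule theta_idem) (simp_all add: mult.assoc sinv_comm ea)
  then show ?thesis
    unfolding eq by (rule idem_mult[OF _ f])
qed

end

theorem theorem8:
  fixes s :: "'a::clifford_semigroup \<times> 'a \<Rightarrow> 'a \<times> 'a"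
  assumes "pentagon_solution s"
  shows "normal_subsemigroup (kernel s)"
proof -
  interpret pentagon "theta s"
    using assms unfolding pentagon_solution_def pentagon_def by (metis comp_apply)
  have kernel: "a \<in> kernel s \<longleftrightarrow> (\<forall>e. e * e = e \<longrightarrow> e * (a * sinv a) = e \<longrightarrow>
      theta s e a * theta s e a = theta s e a)" for a
    by (auto simp: kernel_def idems_def sle_idem)
  have idems: "idems \<subseteq> kernel s"
    unfolding subset_iff kernel by (auto simp: idems_def sinv_idem intro: theta_idem)
  \<comment> \<open>Any element of the type yields an idempotent, so the kernel is nonempty.\<close>
  have "undefined * sinv undefined \<in> (idems :: 'a set)"
    by (simp add: idems_def mult.assoc)
  with idems have "kernel s \<noteq> {}"
    by blast
  moreover have "a * b \<in> kernel s" if "a \<in> kernel s" "b \<in> kernel s" for a b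
    unfolding kernel
  proof (intro allI impI)
    fix e :: 'a
    assume e: "e * e = e" and ab: "e * (a * b * sinv (a * b)) = e"
    show "theta s e (a * b) * theta s e (a * b) = theta s e (a * b)"
      using theta_mult_idem[OF e ab] below_mult[OF ab] e that by (simp add: kernel)
  qed
  moreover have "sinv a * k * a \<in> kernel s" if "k \<in> kernel s" for a k
    unfolding kernel
  proof (intro allI impI)
    fix e :: 'a
    assume e: "e * e = e" and c: "e * (sinv a * k * a * sinv (sinv a * k * a)) = e"
    \<comment> \<open>An \<open>e\<close> below the conjugate is below \<open>k\<close>, so kernel
      membership of \<open>k\<close> can be used at this same \<open>e\<close>.\<close>
    have "e * (k * sinv k) = e"
      using below_mult(2)[OF below_mult(1)[OF c]] .
    then show "theta s e (sinv a * k * a) * theta s e (sinv a * k * a) = theta s e (sinv a * k * a)"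
      using theta_conjugate_idem[OF e c] e that by (simp add: kernel)
  qed
  ultimately show ?thesis
    using idems by (simp add: normal_subsemigroup_def subsemigroup_def)
qed

end
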